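(* Let $A$ be a finite nonempty set. (i) Let $n\ge1$ and let $f:A^n\to A$ satisfy $(\mathbf{C}_{f,f})$. Then $f$ satisfies $$(\mathbf{AB}_f)\quad f(f(x_{11},\dots,x_{1n}),f(x_{21},\dots,x_{2n}),\dots,f(x_{n1},\dots,x_{nn}))=f(x_{11},x_{22},\dots,x_{nn})$$ for all $x_{ij}\in A$ if and only if the graph $$f^{\bullet}:=\{(a_1,\dots,a_n,b)\in A^{n+1}\mid f(a_1,\dots,a_n)=b\}$$ of $f$ is an $(n+1)$-ary generalized quasiorder. (ii) The graph $t^{\bullet}$ of each term operation $t$ of a rectangular algebra $(A,F)$ is a generalized partial order.
   Context: All operations have finite arity $\ge1$. For an $n$-ary $f$ and an $m$-ary $g$ on $A$, $(\mathbf{C}_{f,g})$ is the identity $f(g(x_{11},\dots,x_{1m}),\dots,g(x_{n1},\dots,x_{nm}))= g(f(x_{11},\dots,x_{n1}),\dots,f(x_{1m},\dots,x_{nm}))$ for all $x_{ij}\in A$. An algebra $(A,F)$ of finite type (finitely many fundamental operations) is a rectangular algebra if for all fundamental operations $f,g\in F$ ($f$ $n$-ary) the following hold identically: $f(x,\dots,x)= x$; for each $i\in\{1,\dots,n\}$, $f(x_1,\dots,x_{i-1},f(y_1,\dots,y_{i-1},x_i,y_{i+1},\dots,y_n),x_{i+1},\dots,x_n)= f(x_1,\dots,x_n)$; and $(\mathbf{C}_{f,g})$. Term operations of $(A,F)$ are the operations obtained from projections and the operations in $F$ by composition; the graph $t^{\bullet}$ of a term operation $t$ is defined as for $f$ in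 (i). A relation $\rho\subseteq A^m$ is reflexive if $(a,\dots,a)\in\rho$ for all $a\in A$; it is (generalized) transitive if for every matrix $(a_{ij})\in A^{m\times m}$ all of whose rows and all of whose columns belong to $\rho$, the diagonal $(a_{11},\dots,a_{mm})$ belongs to $\rho$. A generalized quasiorder is a reflexive and transitive relation. For $\rho\subseteq A^m$ put $\rho^{[2]}:=\{(a,b)\in A^2\mid\{a,b\}^m\subseteq\rho\}$. A generalized partial order is a generalized quasiorder $\rho$ with $\rho^{[2]}=\Delta_A=\{(a,a)\mid a\in A\}$.
   Formalization: In (i) the condition (AB_f) is replaced by "f is idempotent, f(x,…,x)=x, and (AB_f)", since for |A|≥2 a constant f satisfies (C_{f,f}) and (AB_f) but its graph is not reflexive. *)

theory Defs
  imports Main "HOL-Library.NList"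
begin

text \<open>
  An n-tuple over A is a list in \<open>nlists n A\<close>, with positions counted from 0. An n-ary operation on A
  is a function on lists of which only the values on \<open>nlists n A\<close> matter: all notions below evaluate
  it there only. Matrices are functions of a row and a column index.
\<close>

definition operation :: "'a set \<Rightarrow> nat \<Rightarrow> ('a list \<Rightarrow> 'a) \<Rightarrow> bool" where
  "operation A n f \<longleftrightarrow> 1 \<le> n \<and> (\<forall>xs\<in>nlists n A. f xs \<in> A)"

definition matrix_on :: "'a set \<Rightarrow> nat \<Rightarrow> nat \<Rightarrow> (nat \<Rightarrow> nat \<Rightarrow> 'a) \<Rightarrow> bool" where
  "matrix_on A n m x \<longleftrightarrow> (\<forall>i<n. \<forall>j<m. x i j \<in> A)"

definition row :: "nat \<Rightarrow> (nat \<Rightarrow> nat \<Rightarrow> 'a) \<Rightarrow> nat \<Rightarrow> 'a list" where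
  "row m x i = map (\<lambda>j. x i j) [0..<m]"

definition col :: "nat \<Rightarrow> (nat \<Rightarrow> nat \<Rightarrow> 'a) \<Rightarrow> nat \<Rightarrow> 'a list" where
  "col n x j = map (\<lambda>i. x i j) [0..<n]"

definition diag :: "nat \<Rightarrow> (nat \<Rightarrow> nat \<Rightarrow> 'a) \<Rightarrow> 'a list" where
  "diag n x = map (\<lambda>i. x i i) [0..<n]"

definition commute ::
  "'a set \<Rightarrow> nat \<Rightarrow> ('a list \<Rightarrow> 'a) \<Rightarrow> nat \<Rightarrow> ('a list \<Rightarrow> 'a) \<Rightarrow> bool" where
  "commute A n f m g \<longleftrightarrow> (\<forall>x. matrix_on A n m x \<longrightarrow>
     f (map (\<lambda>i. g (row m x i)) [0..<n]) = g (map (\<lambda>j. f (col n x j)) [0..<m]))"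

definition AB :: "'a set \<Rightarrow> nat \<Rightarrow> ('a list \<Rightarrow> 'a) \<Rightarrow> bool" where
  "AB A n f \<longleftrightarrow> (\<forall>x. matrix_on A n n x \<longrightarrow>
     f (map (\<lambda>i. f (row n x i)) [0..<n]) = f (diag n x))"

definition idempotent :: "'a set \<Rightarrow> nat \<Rightarrow> ('a list \<Rightarrow> 'a) \<Rightarrow> bool" where
  "idempotent A n f \<longleftrightarrow> (\<forall>a\<in>A. f (replicate n a) = a)"

definition absorptive :: "'a set \<Rightarrow> nat \<Rightarrow> ('a list \<Rightarrow> 'a) \<Rightarrow> bool" where
  "absorptive A n f \<longleftrightarrow> (\<forall>i<n. \<forall>xs\<in>nlists n A. \<forall>ys\<in>nlists n A.
     f (xs[i := f (ys[i := xs ! i])]) = f xs)"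

text \<open>The fundamental operations of an algebra form a set of pairs (arity, operation).\<close>

definition rectangular_algebra :: "'a set \<Rightarrow> (nat \<times> ('a list \<Rightarrow> 'a)) set \<Rightarrow> bool" where
  "rectangular_algebra A F \<longleftrightarrow>
     finite F \<and>
     (\<forall>(n, f)\<in>F. operation A n f \<and> idempotent A n f \<and> absorptive A n f) \<and>
     (\<forall>(n, f)\<in>F. \<forall>(m, g)\<in>F. commute A n f m g)"

text \<open>\<open>term_op F n t\<close>: the n-ary operation \<open>t\<close> is a term operation.\<close>

inductive term_op :: "(nat \<times> ('a list \<Rightarrow> 'a)) set \<Rightarrow> nat \<Rightarrow> ('a list \<Rightarrow> 'a) \<Rightarrow> bool"
  for F where
  proj: "i < n \<Longrightarrow> term_op F n (\<lambda>xs. xs ! i)"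
| fundamental: "(n, f) \<in> F \<Longrightarrow> term_op F n f"
| comp: "term_op F m f \<Longrightarrow> (\<And>i. i < m \<Longrightarrow> term_op F n (g i)) \<Longrightarrow>
    term_op F n (\<lambda>xs. f (map (\<lambda>i. g i xs) [0..<m]))"

definition graph :: "'a set \<Rightarrow> nat \<Rightarrow> ('a list \<Rightarrow> 'a) \<Rightarrow> 'a list set" where
  "graph A n f = {xs @ [b] | xs b. xs \<in> nlists n A \<and> b \<in> A \<and> f xs = b}"

definition reflexive_rel :: "'a set \<Rightarrow> nat \<Rightarrow> 'a list set \<Rightarrow> bool" where
  "reflexive_rel A m \<rho> \<longleftrightarrow> (\<forall>a\<in>A. replicate m a \<in> \<rho>)"

definition transitive_rel :: "'a set \<Rightarrow> nat \<Rightarrow> 'a list set \<Rightarrow> bool" where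
  "transitive_rel A m \<rho> \<longleftrightarrow> (\<forall>x. matrix_on A m m x \<longrightarrow>
     (\<forall>i<m. row m x i \<in> \<rho>) \<longrightarrow> (\<forall>j<m. col m x j \<in> \<rho>) \<longrightarrow> diag m x \<in> \<rho>)"

definition gen_quasiorder :: "'a set \<Rightarrow> nat \<Rightarrow> 'a list set \<Rightarrow> bool" where
  "gen_quasiorder A m \<rho> \<longleftrightarrow>
     \<rho> \<subseteq> nlists m A \<and> reflexive_rel A m \<rho> \<and> transitive_rel A m \<rho>"

definition binary_part :: "'a set \<Rightarrow> nat \<Rightarrow> 'a list set \<Rightarrow> ('a \<times> 'a) set" where
  "binary_part A m \<rho> = {(a, b). a \<in> A \<and> b \<in> A \<and> nlists m {a, b} \<subseteq> \<rho>}"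

definition gen_partial_order :: "'a set \<Rightarrow> nat \<Rightarrow> 'a list set \<Rightarrow> bool" where
  "gen_partial_order A m \<rho> \<longleftrightarrow> gen_quasiorder A m \<rho> \<and> binary_part A m \<rho> = Id_on A"

text \<open>
  The identities \<open>commute A n f n f\<close> and \<open>AB A n f\<close> do not imply idempotence, whereas reflexivity of
  the graph is idempotence: constant operations satisfy both identities, but on a set with two
  elements their graphs are not reflexive. Hence an equivalence between \<open>AB\<close> and the graph being a
  generalized quasiorder has to mention idempotence explicitly.
\<close>

lemma graph_reflexive_iff: "reflexive_rel A (n + 1) (graph A n f) \<longleftrightarrow> idempotent A n f"
proof -
  have eq: "replicate (n + 1) a = replicate n a @ [a]" for a :: 'a
    by (metis Suc_eq_plus1 replicate_Suc replicate_append_same)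
  have "replicate n a @ [a] \<in> graph A n f \<longleftrightarrow> f (replicate n a) = a" if "a \<in> A" for a
  proof -
    have "replicate n a \<in> nlists n A"
      using that by (intro nlistsI) (auto simp: set_replicate_conv_if)
    then show ?thesis
      using that by (auto simp: graph_def)
  qed
  then show ?thesis
    unfolding reflexive_rel_def idempotent_def eq by (rule ball_cong[OF refl])
qed

lemma constant_not_gen_quasiorder:
  assumes "a \<in> A" "b \<in> A" "a \<noteq> b" "1 \<le> n"
  shows "operation A n (\<lambda>xs. a)" "commute A n (\<lambda>xs. a) n (\<lambda>xs. a)" "AB A n (\<lambda>xs. a)"
    and "\<not> gen_quasiorder A (n + 1) (graph A n (\<lambda>xs. a))"
proof -
  show "operation A n (\<lambda>xs. a)"
    using assms(1,4) by (simp add: operation_def)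
  show "commute A n (\<lambda>xs. a) n (\<lambda>xs. a)"
    by (simp add: commute_def)
  show "AB A n (\<lambda>xs. a)"
    by (simp add: AB_def)
  have "\<not> idempotent A n (\<lambda>xs. a)"
    using assms(2,3) by (auto simp: idempotent_def)
  then show "\<not> gen_quasiorder A (n + 1) (graph A n (\<lambda>xs. a))"
    unfolding gen_quasiorder_def graph_reflexive_iff by simp
qed

end

theory Submission
  imports Defs
begin

text \<open>
  The last row and the last column of a matrix whose rows and columns lie in the graph of \<open>f\<close> are
  determined by the upper left n x n block, and the commutation identity says precisely that both
  ways of computing the corner entry agree. So transitivity of the graph says that the diagonal of
  the block is mapped to that corner, which is \<open>AB\<close>.

  For a fundamental operation, \<open>AB\<close> results from absorbing the inner applications of \<open>f\<close> one by one.
  Idempotence, commutation and \<open>AB\<close> pass to compositions; for \<open>AB\<close>, commutation separates the outer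
  operation from the inner ones, so that \<open>AB\<close> can be applied to each of them.
\<close>

section \<open>Tuples and matrices as maps over index ranges\<close>

declare nlistsE_length [simp del] nlistsE_set [simp del]

lemma map_upt_in_nlists: "map a [0..<n] \<in> nlists n A \<longleftrightarrow> (\<forall>i<n. a i \<in> A)"
  by (auto simp: nlists_def)

text \<open>As a congruence rule this gives the simplifier \<open>i < n\<close> inside the map,
  which decides case distinctions on the index.\<close>

lemma map_upt_cong: "(\<And>i. i < n \<Longrightarrow> a i = b i) \<Longrightarrow> map a [0..<n] = map b [0..<n]"
  by simp

lemma operationD: "operation A n f \<Longrightarrow> (\<And>i. i < n \<Longrightarrow> a i \<in> A) \<Longrightarrow> f (map a [0..<n]) \<in> A"
  unfolding operation_def by (metis map_upt_in_nlists)

lemma commuteD: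
  assumes "commute A n f m g" "\<And>i j. i < n \<Longrightarrow> j < m \<Longrightarrow> x i j \<in> A"
  shows "f (map (\<lambda>i. g (map (x i) [0..<m])) [0..<n]) =
         g (map (\<lambda>j. f (map (\<lambda>i. x i j) [0..<n])) [0..<m])"
  using assms by (auto simp: commute_def matrix_on_def row_def col_def)

text \<open>Transposing the matrix exchanges the two sides of the identity.\<close>

lemma commute_sym:
  assumes "commute A n f m g"
  shows "commute A m g n f"
  unfolding commute_def matrix_on_def row_def col_def
proof (intro allI impI)
  fix x
  assume "\<forall>i<m. \<forall>j<n. x i j \<in> A"
  then show "g (map (\<lambda>i. f (map (x i) [0..<n])) [0..<m]) =
      f (map (\<lambda>j. g (map (\<lambda>i. x i j) [0..<m])) [0..<n])"
    using commuteD[OF assms, of "\<lambda>i j. x j i"] by simp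
qed

lemma ABD:
  assumes "AB A n f" "\<And>i j. i < n \<Longrightarrow> j < n \<Longrightarrow> x i j \<in> A"
  shows "f (map (\<lambda>i. f (map (x i) [0..<n])) [0..<n]) = f (map (\<lambda>i. x i i) [0..<n])"
  using assms by (auto simp: AB_def matrix_on_def row_def diag_def)

section \<open>Transitivity of the graph\<close>

lemma map_upt_in_graph:
  "map a [0..<n + 1] \<in> graph A n f \<longleftrightarrow> (\<forall>i\<le>n. a i \<in> A) \<and> f (map a [0..<n]) = a n"
proof -
  have "map a [0..<n + 1] \<in> graph A n f \<longleftrightarrow>
    map a [0..<n] \<in> nlists n A \<and> a n \<in> A \<and> f (map a [0..<n]) = a n"
    by (auto simp: graph_def)
  also have "\<dots> \<longleftrightarrow> (\<forall>i\<le>n. a i \<in> A) \<and> f (map a [0..<n]) = a n"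
    unfolding map_upt_in_nlists by (auto simp: le_less)
  finally show ?thesis .
qed

lemma AB_imp_transitive_graph:
  assumes "AB A n f"
  shows "transitive_rel A (n + 1) (graph A n f)"
  unfolding transitive_rel_def
proof (intro allI impI)
  fix x
  assume x: "matrix_on A (n + 1) (n + 1) x"
    and rows: "\<forall>i<n + 1. row (n + 1) x i \<in> graph A n f"
    and cols: "\<forall>j<n + 1. col (n + 1) x j \<in> graph A n f"
  have xA: "x i j \<in> A" if "i \<le> n" "j \<le> n" for i j
    using x that by (auto simp: matrix_on_def)
  have row_eq: "f (map (x i) [0..<n]) = x i n" if "i < n" for i
    using rows that unfolding row_def map_upt_in_graph by auto
  \<comment> \<open>The last column is a tuple of the graph as well: its value entry is the corner,
    its arguments are the values of the first \<open>n\<close> rows.\<close>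
  have "x n n = f (map (\<lambda>i. x i n) [0..<n])"
    using cols unfolding col_def map_upt_in_graph by auto
  also have "\<dots> = f (map (\<lambda>i. f (map (x i) [0..<n])) [0..<n])"
    by (intro arg_cong[of _ _ f] map_cong) (auto simp: row_eq)
  also have "\<dots> = f (map (\<lambda>i. x i i) [0..<n])"
    by (rule ABD[OF assms]) (auto intro: xA)
  finally show "diag (n + 1) x \<in> graph A n f"
    unfolding diag_def map_upt_in_graph using xA by auto
qed

text \<open>Bordering an n x n matrix by the values of \<open>f\<close> on its rows and columns
  yields a matrix \<open>y\<close> to which transitivity applies.\<close>

lemma transitive_graph_imp_AB:
  assumes f: "operation A n f" and comm: "commute A n f n f"
    and trans: "transitive_rel A (n + 1) (graph A n f)"
  shows "AB A n f"
  unfolding AB_def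
proof (intro allI impI)
  fix x
  assume "matrix_on A n n x"
  then have xA: "x i j \<in> A" if "i < n" "j < n" for i j
    using that by (auto simp: matrix_on_def)
  define r where "r i = f (map (x i) [0..<n])" for i
  define c where "c j = f (map (\<lambda>i. x i j) [0..<n])" for j
  have rA: "r i \<in> A" and cA: "c i \<in> A" if "i < n" for i
    using that by (auto simp: r_def c_def intro!: operationD[OF f] xA)
  \<comment> \<open>\<open>r\<close> is the new last column and \<open>c\<close> the new last row;
    by commutation one corner entry serves both.\<close>
  have corner: "f (map r [0..<n]) = f (map c [0..<n])"
    unfolding r_def[abs_def] c_def[abs_def] by (intro commuteD[OF comm] xA)
  have cornerA: "f (map r [0..<n]) \<in> A"
    by (intro operationD[OF f] rA)
  define y where "y i j =
    (if i < n then if j < n then x i j else r i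
     else if j < n then c j else f (map r [0..<n]))" for i j
  have yA: "y i j \<in> A" for i j
    using xA rA cA cornerA by (auto simp: y_def)
  have "row (n + 1) y i \<in> graph A n f" if "i < n + 1" for i
    unfolding row_def map_upt_in_graph using yA corner
    by (auto simp: y_def r_def cong: map_upt_cong)
  moreover have "col (n + 1) y j \<in> graph A n f" if "j < n + 1" for j
    unfolding col_def map_upt_in_graph using yA corner
    by (auto simp: y_def c_def cong: map_upt_cong)
  ultimately have "diag (n + 1) y \<in> graph A n f"
    using trans yA by (auto simp: transitive_rel_def matrix_on_def)
  then have "f (map (\<lambda>i. y i i) [0..<n]) = y n n"
    unfolding diag_def map_upt_in_graph by blast
  then show "f (map (\<lambda>i. f (row n x i)) [0..<n]) = f (diag n x)"
    by (simp add: y_def r_def row_def diag_def cong: map_upt_cong)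
qed

lemma gen_quasiorder_graph_iff:
  assumes "operation A n f" "commute A n f n f"
  shows "gen_quasiorder A (n + 1) (graph A n f) \<longleftrightarrow> idempotent A n f \<and> AB A n f"
proof -
  have "graph A n f \<subseteq> nlists (n + 1) A"
    by (auto simp: graph_def nlists_def)
  then show ?thesis
    using AB_imp_transitive_graph transitive_graph_imp_AB[OF assms]
    unfolding gen_quasiorder_def graph_reflexive_iff by blast
qed

section \<open>From absorption to \<open>AB\<close>\<close>

lemma absorptive_imp_AB:
  assumes f: "operation A n f" and abs: "absorptive A n f"
  shows "AB A n f"
  unfolding AB_def
proof (intro allI impI)
  fix x
  assume "matrix_on A n n x"
  then have xA: "x i j \<in> A" if "i < n" "j < n" for i j
    using that by (auto simp: matrix_on_def)
  \<comment> \<open>\<open>L\<close> interpolates between the tuple of inner values at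
    \<open>k = 0\<close> and the diagonal at \<open>k = n\<close>.\<close>
  define L where "L k = map (\<lambda>i. if i < k then x i i else f (row n x i)) [0..<n]" for k
  have LA: "L k \<in> nlists n A" for k
    unfolding L_def map_upt_in_nlists row_def by (auto intro!: operationD[OF f] xA)
  have "f (L k) = f (L 0)" if "k \<le> n" for k
    using that
  proof (induction k)
    case (Suc k)
    have rowA: "row n x k \<in> nlists n A"
      unfolding row_def map_upt_in_nlists using Suc.prems xA by auto
    \<comment> \<open>Absorption is applied to \<open>L (Suc k)\<close> at position
      \<open>k\<close>, with row \<open>k\<close> as the inner tuple. That row already carries
      \<open>x k k\<close> at position \<open>k\<close>, so the inserted value is \<open>f\<close>
      of the row itself and the update gives back \<open>L k\<close>.\<close>
    have "(row n x k)[k := L (Suc k) ! k] = row n x k"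
      using Suc.prems by (intro nth_equalityI) (auto simp: row_def L_def nth_list_update)
    moreover have "(L (Suc k))[k := f (row n x k)] = L k"
      by (intro nth_equalityI) (auto simp: L_def nth_list_update)
    ultimately have "f (L k) = f (L (Suc k))"
      using abs LA rowA Suc.prems unfolding absorptive_def by (metis Suc_le_lessD)
    with Suc show ?case by simp
  qed simp
  from this[of n] show "f (map (\<lambda>i. f (row n x i)) [0..<n]) = f (diag n x)"
    by (simp add: L_def diag_def cong: map_upt_cong)
qed

section \<open>Closure under composition\<close>

context
  fixes A :: "'a set" and m n :: nat and f :: "'a list \<Rightarrow> 'a" and g :: "nat \<Rightarrow> 'a list \<Rightarrow> 'a"
  assumes f: "operation A m f" and g: "\<And>l. l < m \<Longrightarrow> operation A n (g l)"
begin

lemma operation_comp: "operation A n (\<lambda>xs. f (map (\<lambda>l. g l xs) [0..<m]))"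
proof -
  \<comment> \<open>As \<open>m\<close> is positive, \<open>g 0\<close> is one of the inner
    operations and supplies the bound.\<close>
  have "1 \<le> n"
    using f g[of 0] by (auto simp: operation_def)
  then show ?thesis
    using f g by (auto simp: operation_def map_upt_in_nlists)
qed

text \<open>\<open>h\<close> is pulled out through each inner \<open>g l\<close> first and through
  \<open>f\<close> afterwards.\<close>

lemma commute_comp:
  assumes fh: "commute A m f k h" and gh: "\<And>l. l < m \<Longrightarrow> commute A n (g l) k h"
  shows "commute A n (\<lambda>xs. f (map (\<lambda>l. g l xs) [0..<m])) k h"
  unfolding commute_def row_def col_def
proof (intro allI impI)
  fix x
  assume "matrix_on A n k x"
  then have xA: "x i j \<in> A" if "i < n" "j < k" for i j
    using that by (auto simp: matrix_on_def)
  have "f (map (\<lambda>l. g l (map (\<lambda>i. h (map (x i) [0..<k])) [0..<n])) [0..<m])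
      = f (map (\<lambda>l. h (map (\<lambda>j. g l (map (\<lambda>i. x i j) [0..<n])) [0..<k])) [0..<m])"
    by (intro arg_cong[of _ _ f] map_cong refl commuteD[OF gh] xA) auto
  also have "\<dots> = h (map (\<lambda>j. f (map (\<lambda>l. g l (map (\<lambda>i. x i j) [0..<n])) [0..<m])) [0..<k])"
    by (intro commuteD[OF fh] operationD[OF g] xA)
  finally show "f (map (\<lambda>l. g l (map (\<lambda>i. h (map (x i) [0..<k])) [0..<n])) [0..<m]) = \<dots>" .
qed

lemma AB_comp:
  assumes f_AB: "AB A m f" and g_AB: "\<And>l. l < m \<Longrightarrow> AB A n (g l)"
    and gf: "\<And>l. l < m \<Longrightarrow> commute A n (g l) m f"
  shows "AB A n (\<lambda>xs. f (map (\<lambda>l. g l xs) [0..<m]))"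
  unfolding AB_def row_def diag_def
proof (intro allI impI)
  fix x
  assume "matrix_on A n n x"
  then have xA: "x i j \<in> A" if "i < n" "j < n" for i j
    using that by (auto simp: matrix_on_def)
  let ?r = "\<lambda>i. map (x i) [0..<n]"
  have grA: "g l (?r i) \<in> A" if "l < m" "i < n" for l i
    using that by (intro operationD[OF g] xA)
  \<comment> \<open>Exchanging each outer \<open>g k\<close> with the \<open>f\<close> inside it
    brings the two layers of \<open>f\<close> together.\<close>
  have "f (map (\<lambda>k. g k (map (\<lambda>i. f (map (\<lambda>l. g l (?r i)) [0..<m])) [0..<n])) [0..<m])
      = f (map (\<lambda>k. f (map (\<lambda>l. g k (map (\<lambda>i. g l (?r i)) [0..<n])) [0..<m])) [0..<m])"
    by (intro arg_cong[of _ _ f] map_cong refl commuteD[OF gf] grA) auto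
  \<comment> \<open>\<open>AB\<close> for \<open>f\<close> reduces the m x m matrix indexed by
    \<open>k\<close> and \<open>l\<close> to its diagonal, where both inner layers carry the same
    \<open>g k\<close>.\<close>
  also have "\<dots> = f (map (\<lambda>k. g k (map (\<lambda>i. g k (?r i)) [0..<n])) [0..<m])"
    by (intro ABD[OF f_AB] operationD[OF g] grA)
  also have "\<dots> = f (map (\<lambda>k. g k (map (\<lambda>i. x i i) [0..<n])) [0..<m])"
    by (intro arg_cong[of _ _ f] map_cong refl ABD[OF g_AB] xA) auto
  finally show "f (map (\<lambda>k. g k (map (\<lambda>i. f (map (\<lambda>l. g l (?r i)) [0..<m])) [0..<n])) [0..<m])
      = \<dots>" .
qed

end

lemma idempotent_comp:
  assumes "idempotent A m f" "\<And>l. l < m \<Longrightarrow> idempotent A n (g l)"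
  shows "idempotent A n (\<lambda>xs. f (map (\<lambda>l. g l xs) [0..<m]))"
  unfolding idempotent_def
proof
  fix a
  assume a: "a \<in> A"
  then have "map (\<lambda>l. g l (replicate n a)) [0..<m] = replicate m a"
    using assms(2) by (intro nth_equalityI) (auto simp: idempotent_def)
  with a assms(1) show "f (map (\<lambda>l. g l (replicate n a)) [0..<m]) = a"
    by (simp add: idempotent_def)
qed

section \<open>Term operations\<close>

lemma operation_proj: "i < n \<Longrightarrow> operation A n (\<lambda>xs. xs ! i)"
  by (auto simp: operation_def nlists_def)

lemma commute_proj: "i < n \<Longrightarrow> commute A n (\<lambda>xs. xs ! i) m h"
  by (auto simp: commute_def row_def col_def)

lemma term_op_operation:
  assumes "term_op F n t" "\<And>n f. (n, f) \<in> F \<Longrightarrow> operation A n f"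
  shows "operation A n t"
  using assms(1)
proof induction
  case (proj i n)
  then show ?case by (rule operation_proj)
next
  case (fundamental n f)
  then show ?case by (rule assms(2))
next
  case (comp m f n g)
  then show ?case by (intro operation_comp)
qed

text \<open>Induction on one side only: \<open>h\<close> stays fixed and need not be fundamental, so
  that a term operation can take its place later.\<close>

lemma term_op_commute_operation:
  assumes "term_op F n t" and F: "\<And>n f. (n, f) \<in> F \<Longrightarrow> operation A n f"
    and "\<And>n f. (n, f) \<in> F \<Longrightarrow> commute A n f m h"
  shows "commute A n t m h"
  using assms(1)
proof induction
  case (proj i n)
  then show ?case by (rule commute_proj)
next
  case (fundamental n f)
  then show ?case by (rule assms(3))
next
  case (comp l f n g)
  show ?case
  proof (rule commute_comp)
    show "operation A l f"
      by (rule term_op_operation[OF comp.hyps(1) F])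
    show "operation A n (g i)" if "i < l" for i
      by (rule term_op_operation[OF comp.hyps(2)[OF that] F])
  qed (rule comp.IH)+
qed

text \<open>The one-sided result is used twice: \<open>t\<close> commutes with every fundamental
  operation, and by symmetry this is what the induction on \<open>s\<close> asks for.\<close>

lemma term_ops_commute:
  assumes s: "term_op F n s" and t: "term_op F m t"
    and F: "\<And>n f. (n, f) \<in> F \<Longrightarrow> operation A n f"
    and comm: "\<And>n f m g. (n, f) \<in> F \<Longrightarrow> (m, g) \<in> F \<Longrightarrow> commute A n f m g"
  shows "commute A n s m t"
proof (rule term_op_commute_operation[OF s F])
  fix k h
  assume "(k, h) \<in> F"
  then show "commute A k h m t"
    by (intro commute_sym[OF term_op_commute_operation[OF t F]] comm)
qed

lemma term_op_idempotent:
  assumes "term_op F n t" "\<And>n f. (n, f) \<in> F \<Longrightarrow> idempotent A n f"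
  shows "idempotent A n t"
  using assms(1)
proof induction
  case (proj i n)
  then show ?case by (simp add: idempotent_def)
next
  case (fundamental n f)
  then show ?case by (rule assms(2))
next
  case (comp m f n g)
  then show ?case by (intro idempotent_comp)
qed

lemma term_op_AB:
  assumes "term_op F n t"
    and F: "\<And>n f. (n, f) \<in> F \<Longrightarrow> operation A n f"
    and comm: "\<And>n f m g. (n, f) \<in> F \<Longrightarrow> (m, g) \<in> F \<Longrightarrow> commute A n f m g"
    and "\<And>n f. (n, f) \<in> F \<Longrightarrow> AB A n f"
  shows "AB A n t"
  using assms(1)
proof induction
  case (proj i n)
  then show ?case by (simp add: AB_def row_def diag_def)
next
  case (fundamental n f)
  then show ?case by (rule assms(4))
next
  case (comp m f n g)
  show ?case
  proof (rule AB_comp)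
    show "operation A m f"
      by (rule term_op_operation[OF comp.hyps(1) F])
    show "operation A n (g i)" if "i < m" for i
      by (rule term_op_operation[OF comp.hyps(2)[OF that] F])
    \<comment> \<open>The inner and outer operations are themselves term operations, so commutation
      of the fundamental ones has to be lifted to both sides.\<close>
    show "commute A n (g i) m f" if "i < m" for i
      by (rule term_ops_commute[OF comp.hyps(2)[OF that] comp.hyps(1) F comm])
  qed (rule comp.IH)+
qed

section \<open>Generalized partial orders\<close>

lemma binary_part_graph:
  assumes "idempotent A n f"
  shows "binary_part A (n + 1) (graph A n f) = Id_on A"
proof (intro equalityI subrelI)
  fix a b
  assume "(a, b) \<in> binary_part A (n + 1) (graph A n f)"
  then have a: "a \<in> A" and sub: "nlists (n + 1) {a, b} \<subseteq> graph A n f"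
    by (auto simp: binary_part_def)
  \<comment> \<open>This single tuple is decisive: in the graph it says that \<open>f\<close> maps
    the constant tuple of \<open>a\<close> to \<open>b\<close>, while idempotence gives
    \<open>a\<close>.\<close>
  have "replicate n a @ [b] \<in> nlists (n + 1) {a, b}"
    by (auto simp: nlists_def)
  then have "replicate n a @ [b] \<in> graph A n f"
    by (rule subsetD[OF sub])
  then have "f (replicate n a) = b"
    by (auto simp: graph_def)
  with a assms show "(a, b) \<in> Id_on A"
    by (auto simp: idempotent_def)
next
  fix a b
  assume "(a, b) \<in> Id_on A"
  then have ab: "a \<in> A" "b = a"
    by auto
  have "nlists (n + 1) {a} \<subseteq> {replicate (n + 1) a}"
    by (simp only: nlists_singleton order_refl)
  moreover have "replicate (n + 1) a \<in> graph A n f"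
    using assms ab graph_reflexive_iff[of A n f] by (simp add: reflexive_rel_def)
  ultimately show "(a, b) \<in> binary_part A (n + 1) (graph A n f)"
    using ab by (auto simp: binary_part_def)
qed

text \<open>Idempotence, \<open>AB\<close> and commutation lift from the fundamental operations to
  \<open>t\<close>; together they make the graph a generalized quasiorder, and idempotence also
  trivializes its binary part.\<close>

lemma rectangular_term_graph:
  assumes "rectangular_algebra A F" and t: "term_op F n t"
  shows "gen_partial_order A (n + 1) (graph A n t)"
proof -
  have F: "operation A n f" "idempotent A n f" "absorptive A n f" if "(n, f) \<in> F" for n f
    using assms(1) that by (auto simp: rectangular_algebra_def)
  have comm: "commute A n f m g" if "(n, f) \<in> F" "(m, g) \<in> F" for n f m g
    using assms(1) that by (fastforce simp: rectangular_algebra_def)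
  have idem: "idempotent A n t"
    by (rule term_op_idempotent[OF t F(2)])
  moreover have "AB A n t"
    using t F(1) comm by (rule term_op_AB) (auto intro: absorptive_imp_AB F)
  moreover have "operation A n t"
    by (rule term_op_operation[OF t F(1)])
  moreover have "commute A n t n t"
    by (rule term_ops_commute[OF t t F(1) comm])
  ultimately show ?thesis
    unfolding gen_partial_order_def
    using gen_quasiorder_graph_iff binary_part_graph by blast
qed

theorem theorem6p3:
  fixes A :: "'a set"
  assumes "finite A" and "A \<noteq> {}"
  shows
    "(\<forall>n f. operation A n f \<longrightarrow> commute A n f n f \<longrightarrow>
        (idempotent A n f \<and> AB A n f \<longleftrightarrow> gen_quasiorder A (n + 1) (graph A n f))) \<and>
     (\<forall>F n t. rectangular_algebra A F \<longrightarrow> term_op F n t \<longrightarrow>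
        gen_partial_order A (n + 1) (graph A n t))"
  by (intro conjI allI impI gen_quasiorder_graph_iff[symmetric] rectangular_term_graph)

end
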